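(* Let $X$ be a Hausdorff topological space and let $Y$ be a $T_1$ regular topological space. Let $F$ be a set-valued map from $X$ to $Y$. Then the following are equivalent: (1) $F$ is a minimal usco map; (2) there is a densely defined quasicontinuous, subcontinuous selection $f$ of $F$ such that $\overline{f} = F$.
   Context: A set-valued map (or map) $F$ from $X$ to $Y$ assigns to each $x\in X$ a (possibly empty) subset $F(x)\subset Y$; it is identified with its graph $\{(x,y)\in X\times Y: y\in F(x)\}$. For $U\subset X$, $F(U)=\bigcup\{F(u):u\in U\}$. For maps $F,G$, $G\subset F$ means $G(x)\subset F(x)$ for all $x\in X$. $F$ is upper semicontinuous if for every $x\in X$ and every open $V\supset F(x)$ there is an open neighborhood $U$ of $x$ with $F(U)\subset V$. $F$ is usco if it is upper semicontinuous with nonempty compact values. $F$ is minimal usco if it is usco and does not properly contain any other usco map from $X$ to $Y$. A densely defined function is a function $f:A\to Y$ where $A=\mathrm{dom} f$ is a dense subset of $X$; it is a densely defined selection of $F$ if $f(x)\in F(x)$ for every $x\in \mathrm{dom} f$. It is quasicontinuous if it is quasicontinuous on $\mathrm{dom} f$ with the induced topology: for every $x\in\mathrm{dom} f$, every neighborhood $V$ of $f(x)$ and every open neighborhood $U$ of $x$ in $\mathrm{dom} f$ there is a nonempty relatively open set $G\subset U$ of $\mathrm{dom} f$ with $f(G)\subset V$. It is subcontinuous if for every $x\in X$ (not only $x\in\mathrm{dom} f$) and every net $(x_i)$ in $\mathrm{dom} f$ converging to $x$, the net $(f(x_i))$ has a convergent subnet in $Y$. $\overline{f}$ denotes the closure of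 the graph of $f$ in $X\times Y$, and $\overline{f}=F$ means that this closure equals the graph of $F$. *)

theory Defs
  imports "HOL-Analysis.Analysis"
begin

section \<open>Set-valued maps\<close>

text \<open>
  Spaces are abstract topologies. A set-valued map from \<open>X\<close> to \<open>Y\<close> is a function
  \<open>F :: 'a \<Rightarrow> 'b set\<close> of which only the values on \<open>topspace X\<close> matter; in particular, inclusion
  and equality of such maps are tested on \<open>topspace X\<close> only.
\<close>

definition set_valued_map :: "'a topology \<Rightarrow> 'b topology \<Rightarrow> ('a \<Rightarrow> 'b set) \<Rightarrow> bool" where
  "set_valued_map X Y F \<longleftrightarrow> (\<forall>x\<in>topspace X. F x \<subseteq> topspace Y)"

definition map_graph :: "'a topology \<Rightarrow> ('a \<Rightarrow> 'b set) \<Rightarrow> ('a \<times> 'b) set" where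
  "map_graph X F = {(x, y). x \<in> topspace X \<and> y \<in> F x}"

definition upper_semicontinuous :: "'a topology \<Rightarrow> 'b topology \<Rightarrow> ('a \<Rightarrow> 'b set) \<Rightarrow> bool" where
  "upper_semicontinuous X Y F \<longleftrightarrow>
     (\<forall>x\<in>topspace X. \<forall>V. openin Y V \<and> F x \<subseteq> V \<longrightarrow>
        (\<exists>U. openin X U \<and> x \<in> U \<and> (\<Union>u\<in>U. F u) \<subseteq> V))"

definition usco :: "'a topology \<Rightarrow> 'b topology \<Rightarrow> ('a \<Rightarrow> 'b set) \<Rightarrow> bool" where
  "usco X Y F \<longleftrightarrow>
     set_valued_map X Y F \<and> upper_semicontinuous X Y F \<and>
     (\<forall>x\<in>topspace X. F x \<noteq> {} \<and> compactin Y (F x))"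

definition minimal_usco :: "'a topology \<Rightarrow> 'b topology \<Rightarrow> ('a \<Rightarrow> 'b set) \<Rightarrow> bool" where
  "minimal_usco X Y F \<longleftrightarrow>
     usco X Y F \<and>
     (\<forall>G. usco X Y G \<and> (\<forall>x\<in>topspace X. G x \<subseteq> F x) \<longrightarrow> (\<forall>x\<in>topspace X. G x = F x))"

section \<open>Nets\<close>

text \<open>
  A net is given by a directed set \<open>(D, le)\<close> with carrier \<open>D :: 'i set\<close> and a function on it; only
  the restriction of the relation and of the function to \<open>D\<close> matters.
\<close>

definition directed_by :: "'i set \<Rightarrow> ('i \<Rightarrow> 'i \<Rightarrow> bool) \<Rightarrow> bool" where
  "directed_by D le \<longleftrightarrow>
     D \<noteq> {} \<and>
     (\<forall>i\<in>D. le i i) \<and>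
     (\<forall>i\<in>D. \<forall>j\<in>D. \<forall>k\<in>D. le i j \<and> le j k \<longrightarrow> le i k) \<and>
     (\<forall>i\<in>D. \<forall>j\<in>D. \<exists>k\<in>D. le i k \<and> le j k)"

definition net_converges ::
    "'a topology \<Rightarrow> 'i set \<Rightarrow> ('i \<Rightarrow> 'i \<Rightarrow> bool) \<Rightarrow> ('i \<Rightarrow> 'a) \<Rightarrow> 'a \<Rightarrow> bool" where
  "net_converges X D le x l \<longleftrightarrow>
     l \<in> topspace X \<and>
     (\<forall>U. openin X U \<and> l \<in> U \<longrightarrow> (\<exists>i\<in>D. \<forall>j\<in>D. le i j \<longrightarrow> x j \<in> U))"

text \<open>Subnets in the sense of Kelley: \<open>x \<circ> p\<close> is a subnet of \<open>x\<close> if the index map \<open>p\<close> satisfies:\<close>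

definition subnet_index_map ::
    "'i set \<Rightarrow> ('i \<Rightarrow> 'i \<Rightarrow> bool) \<Rightarrow> 'j set \<Rightarrow> ('j \<Rightarrow> 'j \<Rightarrow> bool) \<Rightarrow> ('j \<Rightarrow> 'i) \<Rightarrow> bool" where
  "subnet_index_map D le E le' p \<longleftrightarrow>
     p \<in> E \<rightarrow> D \<and> (\<forall>i\<in>D. \<exists>e\<in>E. \<forall>e'\<in>E. le' e e' \<longrightarrow> le i (p e'))"

text \<open>
  HOL cannot quantify over the type of the indices of the subnet inside a formula. The type
  \<open>'i \<times> 'b set\<close> is large enough: see \<open>has_convergent_subnetI\<close> below, where the subnet
  may be indexed by an arbitrary type.
\<close>

definition has_convergent_subnet ::
    "'b topology \<Rightarrow> 'i set \<Rightarrow> ('i \<Rightarrow> 'i \<Rightarrow> bool) \<Rightarrow> ('i \<Rightarrow> 'b) \<Rightarrow> bool" where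
  "has_convergent_subnet Y D le y \<longleftrightarrow>
     (\<exists>(E :: ('i \<times> 'b set) set) le' p l.
        directed_by E le' \<and> subnet_index_map D le E le' p \<and> net_converges Y E le' (y \<circ> p) l)"

lemma
  assumes "directed_by D le"
  shows directed_by_nonempty: "D \<noteq> {}"
    and directed_by_refl: "i \<in> D \<Longrightarrow> le i i"
    and directed_by_trans: "i \<in> D \<Longrightarrow> j \<in> D \<Longrightarrow> k \<in> D \<Longrightarrow> le i j \<Longrightarrow> le j k \<Longrightarrow> le i k"
    and directed_by_ub: "i \<in> D \<Longrightarrow> j \<in> D \<Longrightarrow> \<exists>k\<in>D. le i k \<and> le j k"
  using assms unfolding directed_by_def by blast+

lemma cluster_point_if_subnet:
  assumes "directed_by E le'" "subnet_index_map D le E le' p" "net_converges Y E le' (y \<circ> p) l"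
  shows "\<forall>U. openin Y U \<and> l \<in> U \<longrightarrow> (\<forall>i\<in>D. \<exists>j\<in>D. le i j \<and> y j \<in> U)"
proof (intro allI impI ballI)
  fix U i assume U: "openin Y U \<and> l \<in> U" and i: "i \<in> D"
  obtain a where a: "a \<in> E" "\<forall>e\<in>E. le' a e \<longrightarrow> y (p e) \<in> U"
    using assms(3) U unfolding net_converges_def by auto
  obtain b where b: "b \<in> E" "\<forall>e\<in>E. le' b e \<longrightarrow> le i (p e)"
    using assms(2) i unfolding subnet_index_map_def by blast
  obtain c where c: "c \<in> E" "le' a c" "le' b c"
    using directed_by_ub[OF assms(1) a(1) b(1)] by blast
  have "p c \<in> D" using assms(2) c(1) unfolding subnet_index_map_def by auto
  then show "\<exists>j\<in>D. le i j \<and> y j \<in> U" using a b c by blast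
qed

lemma has_convergent_subnet_iff_cluster_point:
  fixes Y :: "'b topology" and D :: "'i set"
  assumes "directed_by D le"
  shows "has_convergent_subnet Y D le y \<longleftrightarrow>
    (\<exists>l\<in>topspace Y. \<forall>U. openin Y U \<and> l \<in> U \<longrightarrow> (\<forall>i\<in>D. \<exists>j\<in>D. le i j \<and> y j \<in> U))"
proof
  assume "has_convergent_subnet Y D le y"
  then obtain E :: "('i \<times> 'b set) set" and le' p l where
    E: "directed_by E le'" "subnet_index_map D le E le' p" "net_converges Y E le' (y \<circ> p) l"
    unfolding has_convergent_subnet_def by (elim exE conjE)
  have "l \<in> topspace Y" using E(3) unfolding net_converges_def by simp
  then show "\<exists>l\<in>topspace Y. \<forall>U. openin Y U \<and> l \<in> U \<longrightarrow> (\<forall>i\<in>D. \<exists>j\<in>D. le i j \<and> y j \<in> U)"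
    using cluster_point_if_subnet[OF E] by (intro bexI)
next
  assume "\<exists>l\<in>topspace Y. \<forall>U. openin Y U \<and> l \<in> U \<longrightarrow> (\<forall>i\<in>D. \<exists>j\<in>D. le i j \<and> y j \<in> U)"
  then obtain l where l: "l \<in> topspace Y"
    and cl0: "\<forall>U. openin Y U \<and> l \<in> U \<longrightarrow> (\<forall>i\<in>D. \<exists>j\<in>D. le i j \<and> y j \<in> U)" by (elim bexE)
  have cl: "\<exists>j\<in>D. le i j \<and> y j \<in> U" if "openin Y U" "l \<in> U" "i \<in> D" for U i
    using cl0 that by simp
  define E where "E = {(j, U). j \<in> D \<and> openin Y U \<and> l \<in> U \<and> y j \<in> U}"
  define le' where "le' = (\<lambda>(i, U) (j, V). le i j \<and> V \<subseteq> (U :: 'b set))"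
  have top: "\<exists>e\<in>E. \<exists>j. e = (j, topspace Y) \<and> le i j" if "i \<in> D" for i
    using cl[OF openin_topspace l that] l unfolding E_def by auto
  have "directed_by E le'"
    unfolding directed_by_def
  proof (intro conjI ballI impI)
    show "E \<noteq> {}" using top directed_by_nonempty[OF assms] by blast
    show "le' e e" if "e \<in> E" for e
      using that directed_by_refl[OF assms] unfolding E_def le'_def by auto
    show "le' a c" if "a \<in> E" "b \<in> E" "c \<in> E" "le' a b \<and> le' b c" for a b c
    proof -
      obtain i U j V k W where abc: "a = (i, U)" "b = (j, V)" "c = (k, W)"
        by (metis surj_pair)
      have "i \<in> D" "j \<in> D" "k \<in> D" "le i j" "le j k"
        using that unfolding abc E_def le'_def by auto
      then have "le i k" by (rule directed_by_trans[OF assms])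
      then show ?thesis using that unfolding abc le'_def by auto
    qed
    show "\<exists>c\<in>E. le' a c \<and> le' b c" if mem: "a \<in> E" "b \<in> E" for a b
    proof -
      obtain i U j V where ab: "a = (i, U)" "b = (j, V)" by (metis surj_pair)
      have ij: "i \<in> D" "j \<in> D" "openin Y (U \<inter> V)" "l \<in> U \<inter> V"
        using that unfolding ab E_def by auto
      obtain k where k: "k \<in> D" "le i k" "le j k"
        using directed_by_ub[OF assms ij(1,2)] by blast
      obtain m where m: "m \<in> D" "le k m" "y m \<in> U \<inter> V" using cl[OF ij(3,4) k(1)] by blast
      have "le i m" "le j m"
        using directed_by_trans[OF assms ij(1) k(1) m(1)]
          directed_by_trans[OF assms ij(2) k(1) m(1)] k m by auto
      then have "le' a (m, U \<inter> V) \<and> le' b (m, U \<inter> V)" unfolding ab le'_def by auto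
      moreover have "(m, U \<inter> V) \<in> E" using ij m unfolding E_def by auto
      ultimately show ?thesis by blast
    qed
  qed
  moreover have "subnet_index_map D le E le' fst"
    unfolding subnet_index_map_def
  proof (intro conjI ballI)
    show "fst \<in> E \<rightarrow> D" unfolding E_def by auto
    fix i assume i: "i \<in> D"
    obtain j where j: "(j, topspace Y) \<in> E" "le i j" using top[OF i] by blast
    have "le i (fst e)" if "e \<in> E" "le' (j, topspace Y) e" for e
    proof -
      obtain k W where e: "e = (k, W)" by (metis surj_pair)
      have "k \<in> D" "j \<in> D" "le j k" using that j unfolding e E_def le'_def by auto
      then show ?thesis using directed_by_trans[OF assms i, of j k] j unfolding e by simp
    qed
    then show "\<exists>e\<in>E. \<forall>e'\<in>E. le' e e' \<longrightarrow> le i (fst e')" using j by blast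
  qed
  moreover have "net_converges Y E le' (y \<circ> fst) l"
    unfolding net_converges_def
  proof (intro conjI allI impI)
    show "l \<in> topspace Y" by (rule l)
    fix U assume U: "openin Y U \<and> l \<in> U"
    obtain i where "i \<in> D" using directed_by_nonempty[OF assms] by blast
    then obtain j where j: "j \<in> D" "y j \<in> U" using cl U by blast
    then have "(j, U) \<in> E" using U unfolding E_def by auto
    moreover have "\<forall>e\<in>E. le' (j, U) e \<longrightarrow> (y \<circ> fst) e \<in> U"
      unfolding E_def le'_def by auto
    ultimately show "\<exists>e\<in>E. \<forall>e'\<in>E. le' e e' \<longrightarrow> (y \<circ> fst) e' \<in> U" by blast
  qed
  ultimately show "has_convergent_subnet Y D le y"
    unfolding has_convergent_subnet_def by (intro exI conjI)
qed

lemma has_convergent_subnetI: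
  fixes E :: "'j set"
  assumes "directed_by D le" "directed_by E le'"
    and "subnet_index_map D le E le' p" "net_converges Y E le' (y \<circ> p) l"
  shows "has_convergent_subnet Y D le y"
  using cluster_point_if_subnet[OF assms(2-4)] assms(4)
  unfolding has_convergent_subnet_iff_cluster_point[OF assms(1)] net_converges_def by blast

section \<open>Densely defined functions\<close>

text \<open>A densely defined function is a pair of its domain \<open>A\<close> and a function \<open>f\<close> used on \<open>A\<close> only.\<close>

definition densely_defined :: "'a topology \<Rightarrow> 'b topology \<Rightarrow> 'a set \<Rightarrow> ('a \<Rightarrow> 'b) \<Rightarrow> bool" where
  "densely_defined X Y A f \<longleftrightarrow>
     A \<subseteq> topspace X \<and> X closure_of A = topspace X \<and> f \<in> A \<rightarrow> topspace Y"

definition densely_defined_selection ::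
    "'a topology \<Rightarrow> 'b topology \<Rightarrow> ('a \<Rightarrow> 'b set) \<Rightarrow> 'a set \<Rightarrow> ('a \<Rightarrow> 'b) \<Rightarrow> bool" where
  "densely_defined_selection X Y F A f \<longleftrightarrow> densely_defined X Y A f \<and> (\<forall>x\<in>A. f x \<in> F x)"

definition quasicontinuous_on ::
    "'a topology \<Rightarrow> 'b topology \<Rightarrow> 'a set \<Rightarrow> ('a \<Rightarrow> 'b) \<Rightarrow> bool" where
  "quasicontinuous_on X Y A f \<longleftrightarrow>
     (\<forall>x\<in>A. \<forall>V U. openin Y V \<and> f x \<in> V \<and> openin (subtopology X A) U \<and> x \<in> U \<longrightarrow>
        (\<exists>G. openin (subtopology X A) G \<and> G \<noteq> {} \<and> G \<subseteq> U \<and> f ` G \<subseteq> V))"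

text \<open>
  The limit \<open>x\<close> ranges over all of \<open>X\<close>, not just over the domain \<open>A\<close>. Again the type of the
  indices has to be fixed, and \<open>'a \<times> 'a set\<close> is large enough: see \<open>subcontinuous_netD\<close> below.
\<close>

definition subcontinuous ::
    "'a topology \<Rightarrow> 'b topology \<Rightarrow> 'a set \<Rightarrow> ('a \<Rightarrow> 'b) \<Rightarrow> bool" where
  "subcontinuous X Y A f \<longleftrightarrow>
     (\<forall>x\<in>topspace X. \<forall>(D :: ('a \<times> 'a set) set) le s.
        directed_by D le \<and> s \<in> D \<rightarrow> A \<and> net_converges X D le s x \<longrightarrow>
        has_convergent_subnet Y D le (f \<circ> s))"

lemma subcontinuous_netD:
  fixes X :: "'a topology" and Y :: "'b topology" and D :: "'i set"
  assumes "subcontinuous X Y A f" "x \<in> topspace X"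
    and "directed_by D le" "s \<in> D \<rightarrow> A" "net_converges X D le s x"
  shows "has_convergent_subnet Y D le (f \<circ> s)"
proof -
  define tail where "tail i = s ` {j \<in> D. le i j}" for i
  define N where "N = {(a, S). \<exists>i\<in>D. S = tail i \<and> a \<in> S}"
  define le' where "le' = (\<lambda>(a :: 'a, S) (b :: 'a, T). T \<subseteq> (S :: 'a set))"
  have anti: "tail j \<subseteq> tail i" if "i \<in> D" "j \<in> D" "le i j" for i j
  proof
    fix a assume "a \<in> tail j"
    then obtain k where k: "k \<in> D" "le j k" "a = s k" unfolding tail_def by auto
    have "le i k" using directed_by_trans[OF assms(3) that(1,2) k(1) that(3) k(2)] .
    then show "a \<in> tail i" using k unfolding tail_def by auto
  qed
  have inN: "(s i, tail i) \<in> N" if "i \<in> D" for i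
    using directed_by_refl[OF assms(3) that] that unfolding N_def tail_def by auto
  have dir: "directed_by N le'"
    unfolding directed_by_def
  proof (intro conjI ballI impI)
    show "N \<noteq> {}" using inN directed_by_nonempty[OF assms(3)] by blast
    show "le' e e" for e unfolding le'_def by auto
    show "le' a c" if "le' a b \<and> le' b c" for a b c using that unfolding le'_def by auto
    show "\<exists>c\<in>N. le' a c \<and> le' b c" if mem: "a \<in> N" "b \<in> N" for a b
    proof -
      obtain u i where a: "a = (u, tail i)" "i \<in> D" using mem(1) unfolding N_def by blast
      obtain v j where b: "b = (v, tail j)" "j \<in> D" using mem(2) unfolding N_def by blast
      note ab = a(1) b(1) a(2) b(2)
      obtain k where k: "k \<in> D" "le i k" "le j k"
        using directed_by_ub[OF assms(3) ab(3,4)] by blast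
      have "le' a (s k, tail k) \<and> le' b (s k, tail k)"
        using anti ab k unfolding le'_def by auto
      then show ?thesis using inN[OF k(1)] by blast
    qed
  qed
  have "fst \<in> N \<rightarrow> A" using assms(4) unfolding N_def tail_def by auto
  moreover have "net_converges X N le' fst x"
    unfolding net_converges_def
  proof (intro conjI allI impI)
    show "x \<in> topspace X" by (rule assms(2))
    fix U assume "openin X U \<and> x \<in> U"
    then obtain i where i: "i \<in> D" "\<forall>j\<in>D. le i j \<longrightarrow> s j \<in> U"
      using assms(5) unfolding net_converges_def by blast
    have "tail i \<subseteq> U" using i unfolding tail_def by auto
    then have "\<forall>e\<in>N. le' (s i, tail i) e \<longrightarrow> fst e \<in> U"
      unfolding N_def le'_def by auto
    then show "\<exists>e\<in>N. \<forall>e'\<in>N. le' e e' \<longrightarrow> fst e' \<in> U" using inN[OF i(1)] by blast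
  qed
  ultimately have "has_convergent_subnet Y N le' (f \<circ> fst)"
    using assms(1,2) dir unfolding subcontinuous_def by blast
  then obtain l where l: "l \<in> topspace Y"
    and cl0: "\<forall>U. openin Y U \<and> l \<in> U \<longrightarrow> (\<forall>e\<in>N. \<exists>e'\<in>N. le' e e' \<and> (f \<circ> fst) e' \<in> U)"
    unfolding has_convergent_subnet_iff_cluster_point[OF dir] by (elim bexE)
  have cl: "\<exists>e'\<in>N. le' e e' \<and> f (fst e') \<in> U" if "openin Y U" "l \<in> U" "e \<in> N" for U e
    using cl0 that by simp
  have "\<exists>j\<in>D. le i j \<and> (f \<circ> s) j \<in> U" if U: "openin Y U" "l \<in> U" and i: "i \<in> D" for U i
  proof -
    obtain e where e: "e \<in> N" "le' (s i, tail i) e" "f (fst e) \<in> U"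
      using cl[OF U inN[OF i]] by blast
    have "fst e \<in> tail i" using e unfolding N_def le'_def by auto
    then show ?thesis using e(3) unfolding tail_def by auto
  qed
  then show ?thesis
    unfolding has_convergent_subnet_iff_cluster_point[OF assms(3)] using l by blast
qed

definition function_graph :: "'a set \<Rightarrow> ('a \<Rightarrow> 'b) \<Rightarrow> ('a \<times> 'b) set" where
  "function_graph A f = {(x, f x) | x. x \<in> A}"

end

theory Submission
  imports Defs
begin

text \<open>
  A minimal usco map \<open>F\<close> is quasicontinuous in a strong sense: if \<open>F x\<close> meets an open \<open>V\<close>, then every
  neighbourhood of \<open>x\<close> contains a nonempty open set \<open>G\<close> with \<open>F(G) \<subseteq> V\<close>, since otherwise removing \<open>V\<close>
  from the values of \<open>F\<close> near \<open>x\<close> would leave a smaller usco map. Hence any selection of \<open>F\<close> defined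
  on the whole space has the required properties.

  Conversely, if \<open>f\<close> is subcontinuous and \<open>F x\<close> is covered by open sets, then finitely many of them
  cover \<open>f(U)\<close> for some neighbourhood \<open>U\<close> of \<open>x\<close>, for otherwise a net of exceptional points would
  have a cluster point in \<open>F x\<close>. Regularity of \<open>Y\<close> upgrades this from \<open>f\<close> to its closure \<open>F\<close>, which
  yields compactness and upper semicontinuity at once. If a usco map \<open>G \<subseteq> F\<close> missed a point
  \<open>y \<in> F x\<close>, quasicontinuity would give a nonempty open set on which \<open>G\<close> and \<open>f\<close> are separated.
\<close>

section \<open>Neighbourhoods in products and separation by usco maps\<close>

lemma in_closure_of_prod_topology:
  "(x, y) \<in> prod_topology X Y closure_of S \<longleftrightarrow>
    x \<in> topspace X \<and> y \<in> topspace Y \<and>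
    (\<forall>U V. openin X U \<and> openin Y V \<and> x \<in> U \<and> y \<in> V \<longrightarrow> S \<inter> U \<times> V \<noteq> {})"
  (is "?L \<longleftrightarrow> ?R")
proof
  assume L: ?L
  have "S \<inter> U \<times> V \<noteq> {}" if "openin X U" "openin Y V" "x \<in> U" "y \<in> V" for U V
  proof -
    have "openin (prod_topology X Y) (U \<times> V)" "(x, y) \<in> U \<times> V"
      using that by (auto simp: openin_prod_Times_iff)
    then obtain z where "z \<in> S" "z \<in> U \<times> V"
      using L unfolding in_closure_of by metis
    then show ?thesis by blast
  qed
  moreover have "x \<in> topspace X" "y \<in> topspace Y"
    using L closure_of_subset_topspace[of "prod_topology X Y" S] by auto
  ultimately show ?R by simp
next
  assume R: ?R
  have "\<exists>z. z \<in> S \<and> z \<in> T" if T: "(x, y) \<in> T" "openin (prod_topology X Y) T" for T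
  proof -
    obtain U V where "openin X U" "openin Y V" "x \<in> U" "y \<in> V" "U \<times> V \<subseteq> T"
      using T unfolding openin_prod_topology_alt by metis
    moreover from this have "S \<inter> U \<times> V \<noteq> {}" using R by simp
    ultimately show ?thesis by blast
  qed
  then show ?L using R unfolding in_closure_of by simp
qed

lemma upper_semicontinuousD:
  assumes "upper_semicontinuous X Y F" "x \<in> topspace X" "openin Y V" "F x \<subseteq> V"
  obtains U where "openin X U" "x \<in> U" "\<And>u. u \<in> U \<Longrightarrow> F u \<subseteq> V"
proof -
  have "\<exists>U. openin X U \<and> x \<in> U \<and> (\<Union>u\<in>U. F u) \<subseteq> V"
    using assms(1)[unfolded upper_semicontinuous_def, rule_format, OF assms(2)] assms(3,4) by simp
  then obtain U where U: "openin X U" "x \<in> U" "(\<Union>u\<in>U. F u) \<subseteq> V"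
    by (elim exE conjE)
  show thesis by (rule that[OF U(1,2)]) (use U(3) in auto)
qed

text \<open>In a Hausdorff space a compact value and a point outside it have disjoint open
  neighbourhoods; upper semicontinuity then extends the inclusion in \<open>V\<close> from
  \<open>x\<close> to nearby points. In effect, the graph of a usco map is closed.\<close>

lemma usco_separation:
  assumes "Hausdorff_space Y" "usco X Y F" "x \<in> topspace X" "y \<in> topspace Y" "y \<notin> F x"
  obtains U V W where "openin X U" "x \<in> U" "openin Y V" "openin Y W" "y \<in> W" "disjnt V W"
    "\<And>u. u \<in> U \<Longrightarrow> F u \<subseteq> V"
proof -
  have usc: "upper_semicontinuous X Y F"
    and "compactin Y (F x)" "compactin Y {y}" "disjnt (F x) {y}"
    using assms by (auto simp: usco_def)
  then obtain V W where VW: "openin Y V" "openin Y W" "F x \<subseteq> V" "{y} \<subseteq> W" "disjnt V W"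
    using Hausdorff_space_compact_separation[OF assms(1)] by metis
  obtain U where "openin X U" "x \<in> U" "\<And>u. u \<in> U \<Longrightarrow> F u \<subseteq> V"
    using upper_semicontinuousD[OF usc assms(3) VW(1,3)] by blast
  then show thesis using VW that by auto
qed

section \<open>Minimal usco maps and their selections\<close>

text \<open>All that the forward direction needs from minimality beyond \<open>F\<close> being usco.
  If no such \<open>G\<close> existed, no value over \<open>U\<close> could lie inside
  \<open>V\<close>, so cutting \<open>V\<close> out of these values would leave a usco map that is
  smaller at \<open>x\<close>.\<close>

lemma minimal_usco_open_subset:
  assumes min: "minimal_usco X Y F"
    and U: "openin X U" "x \<in> U" and V: "openin Y V" "F x \<inter> V \<noteq> {}"
  obtains G where "openin X G" "G \<noteq> {}" "G \<subseteq> U" "\<And>z. z \<in> G \<Longrightarrow> F z \<subseteq> V"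
proof (rule ccontr)
  assume "\<not> thesis"
  with that have no: "\<exists>z\<in>G. \<not> F z \<subseteq> V" if "openin X G" "G \<noteq> {}" "G \<subseteq> U" for G
    using \<open>openin X G\<close> \<open>G \<noteq> {}\<close> \<open>G \<subseteq> U\<close> by blast
  have us: "usco X Y F" and usc: "upper_semicontinuous X Y F"
    using min unfolding minimal_usco_def usco_def by auto
  have F: "F u \<subseteq> topspace Y" "F u \<noteq> {}" "compactin Y (F u)" if "u \<in> topspace X" for u
    using us that unfolding usco_def set_valued_map_def by auto
  have UX: "U \<subseteq> topspace X" using U openin_subset by blast
  \<comment> \<open>Upper semicontinuity would spread the inclusion to a neighbourhood of
    \<open>u\<close>, whose intersection with \<open>U\<close> is ruled out by \<open>no\<close>.
    Hence the truncated values stay nonempty.\<close>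
  have notsub: "\<not> F u \<subseteq> V" if u: "u \<in> U" for u
  proof
    assume "F u \<subseteq> V"
    then obtain W where W: "openin X W" "u \<in> W" "\<And>w. w \<in> W \<Longrightarrow> F w \<subseteq> V"
      using upper_semicontinuousD[OF usc _ V(1)] u UX by (metis subsetD)
    have "openin X (W \<inter> U)" "W \<inter> U \<noteq> {}" using W U u by auto
    then show False using no W by blast
  qed
  define G where "G u = (if u \<in> U then F u - V else F u)" for u
  have "upper_semicontinuous X Y G"
    unfolding upper_semicontinuous_def
  proof (intro ballI allI impI)
    fix u W assume u: "u \<in> topspace X" and W: "openin Y W \<and> G u \<subseteq> W"
    show "\<exists>N. openin X N \<and> u \<in> N \<and> (\<Union>z\<in>N. G z) \<subseteq> W"
    proof (cases "u \<in> U")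
      case True
      \<comment> \<open>Adding \<open>V\<close> to \<open>W\<close> turns a bound on the truncated
        value into one on \<open>F u\<close>; over \<open>N \<inter> U\<close> the part in
        \<open>V\<close> is removed again.\<close>
      then have "openin Y (W \<union> V)" "F u \<subseteq> W \<union> V" using W V by (auto simp: G_def)
      then obtain N where N: "openin X N" "u \<in> N" "\<And>z. z \<in> N \<Longrightarrow> F z \<subseteq> W \<union> V"
        using upper_semicontinuousD[OF usc u] by metis
      have "(\<Union>z\<in>N \<inter> U. G z) \<subseteq> W" using N(3) by (auto simp: G_def)
      then show ?thesis using N True U by (intro exI[of _ "N \<inter> U"]) auto
    next
      case False
      then have "openin Y W" "F u \<subseteq> W" using W by (auto simp: G_def)
      then obtain N where N: "openin X N" "u \<in> N" "\<And>z. z \<in> N \<Longrightarrow> F z \<subseteq> W"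
        using upper_semicontinuousD[OF usc u] by metis
      \<comment> \<open>Truncation only shrinks values, so it does not matter whether
        \<open>N\<close> meets \<open>U\<close>.\<close>
      have "(\<Union>z\<in>N. G z) \<subseteq> W" using N(3) by (auto simp: G_def split: if_splits)
      then show ?thesis using N by blast
    qed
  qed
  moreover have "compactin Y (G u)" if "u \<in> topspace X" for u
  proof -
    have "F u - V = F u \<inter> (topspace Y - V)" using F(1)[OF that] by blast
    moreover have "closedin Y (topspace Y - V)" using V by blast
    ultimately have "compactin Y (F u - V)"
      using F(3)[OF that] by (simp add: compact_Int_closedin)
    then show ?thesis using F(3)[OF that] by (simp add: G_def)
  qed
  moreover have "set_valued_map X Y G" "\<And>u. u \<in> topspace X \<Longrightarrow> G u \<noteq> {}"
    using F notsub by (auto simp: set_valued_map_def G_def)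
  ultimately have "usco X Y G" unfolding usco_def by simp
  moreover have "\<forall>u\<in>topspace X. G u \<subseteq> F u" by (auto simp: G_def)
  ultimately have "G x = F x" using min U UX unfolding minimal_usco_def by blast
  then show False using U V by (auto simp: G_def)
qed

text \<open>Without a convergent subnet, each point of the compact set \<open>F x\<close> has an
  open neighbourhood that the net of values eventually avoids. Finitely many of these cover
  \<open>F x\<close>, and upper semicontinuity forces the net into their union, a
  contradiction.\<close>

lemma usco_selection_subcontinuous:
  fixes X :: "'a topology" and Y :: "'b topology"
  assumes us: "usco X Y F" and sel: "\<And>x. x \<in> A \<Longrightarrow> f x \<in> F x"
  shows "subcontinuous X Y A f"
  unfolding subcontinuous_def
proof (intro ballI allI impI)
  fix x and D :: "('a \<times> 'a set) set" and le s
  assume x: "x \<in> topspace X"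
    and "directed_by D le \<and> s \<in> D \<rightarrow> A \<and> net_converges X D le s x"
  then have D: "directed_by D le" and s: "s \<in> D \<rightarrow> A" and lim: "net_converges X D le s x" by auto
  have Fx: "F x \<subseteq> topspace Y" "compactin Y (F x)" and usc: "upper_semicontinuous X Y F"
    using us x unfolding usco_def set_valued_map_def by auto
  show "has_convergent_subnet Y D le (f \<circ> s)"
  proof (rule ccontr)
    assume "\<not> has_convergent_subnet Y D le (f \<circ> s)"
    then have no: "\<exists>V. openin Y V \<and> l \<in> V \<and> (\<exists>i\<in>D. \<forall>j\<in>D. le i j \<longrightarrow> f (s j) \<notin> V)"
      if "l \<in> topspace Y" for l
      using that unfolding has_convergent_subnet_iff_cluster_point[OF D] by fastforce
    define \<V> where "\<V> = {V. openin Y V \<and> (\<exists>i\<in>D. \<forall>j\<in>D. le i j \<longrightarrow> f (s j) \<notin> V)}"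
    have "F x \<subseteq> \<Union>\<V>"
    proof
      fix l assume "l \<in> F x"
      then show "l \<in> \<Union>\<V>" using no[of l] Fx(1) unfolding \<V>_def by auto
    qed
    moreover have "Ball \<V> (openin Y)" by (simp add: \<V>_def)
    ultimately have "\<exists>\<F>. finite \<F> \<and> \<F> \<subseteq> \<V> \<and> F x \<subseteq> \<Union>\<F>"
      using Fx(2) unfolding compactin_def by simp
    then obtain \<F> where \<F>: "finite \<F>" "\<F> \<subseteq> \<V>" "F x \<subseteq> \<Union>\<F>"
      by (elim exE conjE)
    \<comment> \<open>Directedness merges the finitely many indices, one for each member of
      \<open>\<F>\<close>, into a single one.\<close>
    have tail: "\<exists>i\<in>D. \<forall>j\<in>D. le i j \<longrightarrow> f (s j) \<notin> \<Union>\<F>"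
      using \<F>(1,2)
    proof induction
      case empty
      then show ?case using directed_by_nonempty[OF D] by auto
    next
      case (insert V \<F>)
      then obtain i j where ij: "i \<in> D" "\<forall>k\<in>D. le i k \<longrightarrow> f (s k) \<notin> V"
        "j \<in> D" "\<forall>k\<in>D. le j k \<longrightarrow> f (s k) \<notin> \<Union>\<F>"
        unfolding \<V>_def by auto
      obtain k where k: "k \<in> D" "le i k" "le j k" using directed_by_ub[OF D ij(1,3)] by blast
      have "f (s m) \<notin> \<Union>(insert V \<F>)" if m: "m \<in> D" "le k m" for m
        using ij(2,4) m directed_by_trans[OF D ij(1) k(1) m(1) k(2) m(2)]
          directed_by_trans[OF D ij(3) k(1) m(1) k(3) m(2)] by auto
      then show ?case using k(1) by blast
    qed
    have "openin Y (\<Union>\<F>)" using \<F>(2) by (auto simp: \<V>_def)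
    then obtain U where U: "openin X U" "x \<in> U" "\<And>u. u \<in> U \<Longrightarrow> F u \<subseteq> \<Union>\<F>"
      using upper_semicontinuousD[OF usc x] \<F>(3) by metis
    obtain i where i: "i \<in> D" "\<forall>j\<in>D. le i j \<longrightarrow> s j \<in> U"
      using lim U unfolding net_converges_def by blast
    obtain j where j: "j \<in> D" "\<forall>k\<in>D. le j k \<longrightarrow> f (s k) \<notin> \<Union>\<F>" using tail by (elim bexE)
    obtain k where k: "k \<in> D" "le i k" "le j k" using directed_by_ub[OF D i(1) j(1)] by blast
    have "s k \<in> U" "f (s k) \<notin> \<Union>\<F>" using i(2) j(2) k by simp_all
    moreover have "f (s k) \<in> F (s k)" using s k(1) sel by blast
    ultimately show False using U(3) by blast
  qed
qed

text \<open>Over the open set from \<open>minimal_usco_open_subset\<close> all values of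
  \<open>F\<close>, hence those of \<open>f\<close>, lie in \<open>V\<close>. This gives
  quasicontinuity and puts the graph of \<open>F\<close> inside the closure; the other inclusion
  holds because a usco map has a closed graph.\<close>

lemma minimal_usco_selection:
  assumes "Hausdorff_space Y" and min: "minimal_usco X Y F"
    and sel: "\<And>x. x \<in> topspace X \<Longrightarrow> f x \<in> F x"
  shows "quasicontinuous_on X Y (topspace X) f"
    and "prod_topology X Y closure_of function_graph (topspace X) f = map_graph X F"
proof -
  have us: "usco X Y F" using min unfolding minimal_usco_def by simp
  show "quasicontinuous_on X Y (topspace X) f"
    unfolding quasicontinuous_on_def subtopology_topspace
  proof (intro ballI allI impI)
    fix x V U assume x: "x \<in> topspace X"
      and VU: "openin Y V \<and> f x \<in> V \<and> openin X U \<and> x \<in> U"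
    then have "openin X U" "x \<in> U" "openin Y V" "F x \<inter> V \<noteq> {}" using sel by auto
    then obtain G where G: "openin X G" "G \<noteq> {}" "G \<subseteq> U" "\<And>z. z \<in> G \<Longrightarrow> F z \<subseteq> V"
      using minimal_usco_open_subset[OF min] by metis
    moreover have "f ` G \<subseteq> V" using G sel openin_subset[OF G(1)] by blast
    ultimately show "\<exists>G. openin X G \<and> G \<noteq> {} \<and> G \<subseteq> U \<and> f ` G \<subseteq> V" by blast
  qed
  show "prod_topology X Y closure_of function_graph (topspace X) f = map_graph X F"
  proof (intro subset_antisym subrelI)
    fix x y
    assume cl: "(x, y) \<in> prod_topology X Y closure_of function_graph (topspace X) f"
    then have xy: "x \<in> topspace X" "y \<in> topspace Y" by (auto simp: in_closure_of_prod_topology)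
    have "y \<in> F x"
    proof (rule ccontr)
      assume "y \<notin> F x"
      then obtain U V W where UVW: "openin X U" "x \<in> U" "openin Y V" "openin Y W" "y \<in> W"
        "disjnt V W" "\<And>u. u \<in> U \<Longrightarrow> F u \<subseteq> V"
        using usco_separation[OF assms(1) us xy] by blast
      then have "function_graph (topspace X) f \<inter> U \<times> W \<noteq> {}"
        using cl by (auto simp: in_closure_of_prod_topology)
      then obtain u where u: "u \<in> topspace X" "u \<in> U" "f u \<in> W"
        by (auto simp: function_graph_def)
      then show False using UVW(6) UVW(7)[of u] sel[of u] unfolding disjnt_def by blast
    qed
    then show "(x, y) \<in> map_graph X F" using xy by (simp add: map_graph_def)
  next
    fix x y
    assume "(x, y) \<in> map_graph X F"
    then have xy: "x \<in> topspace X" "y \<in> F x" by (auto simp: map_graph_def)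
    moreover have "y \<in> topspace Y"
      using us xy unfolding usco_def set_valued_map_def by blast
    moreover have "function_graph (topspace X) f \<inter> U \<times> V \<noteq> {}"
      if UV: "openin X U" "openin Y V" "x \<in> U" "y \<in> V" for U V
    proof -
      have "F x \<inter> V \<noteq> {}" using xy UV by blast
      then obtain G where G: "openin X G" "G \<noteq> {}" "G \<subseteq> U" "\<And>z. z \<in> G \<Longrightarrow> F z \<subseteq> V"
        using minimal_usco_open_subset[OF min UV(1,3,2)] by blast
      obtain z where z: "z \<in> G" using G(2) by blast
      moreover have "z \<in> topspace X" using z openin_subset[OF G(1)] by blast
      ultimately have "(z, f z) \<in> function_graph (topspace X) f \<inter> U \<times> V"
        using G(3) G(4)[of z] sel[of z] by (auto simp: function_graph_def)
      then show ?thesis by blast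
    qed
    ultimately show "(x, y) \<in> prod_topology X Y closure_of function_graph (topspace X) f"
      by (simp add: in_closure_of_prod_topology)
  qed
qed

section \<open>From subcontinuous functions to usco maps\<close>

text \<open>Transfers local bounds from \<open>f\<close> to the closure of its graph, at the price
  of closing the bound.\<close>

lemma closure_function_graph_value:
  assumes cl: "(u, y) \<in> prod_topology X Y closure_of function_graph A f"
    and "openin X U" "u \<in> U" "f ` (U \<inter> A) \<subseteq> W"
  shows "y \<in> Y closure_of W"
  unfolding in_closure_of
proof (intro conjI allI impI)
  show "y \<in> topspace Y" using cl by (simp add: in_closure_of_prod_topology)
  fix T assume "y \<in> T \<and> openin Y T"
  then have "function_graph A f \<inter> U \<times> T \<noteq> {}"
    using assms by (simp add: in_closure_of_prod_topology)
  then show "\<exists>z. z \<in> W \<and> z \<in> T" using assms(4) unfolding function_graph_def by blast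
qed

text \<open>Otherwise choose, for each neighbourhood \<open>U\<close> and finite
  \<open>\<F>\<close>, a point of \<open>U \<inter> A\<close> with image outside
  \<open>\<Union>\<F>\<close>. This net converges to \<open>x\<close>, and a cluster point of its
  images lies in the closure of the graph over \<open>x\<close>, hence in some member of
  \<open>\<V>\<close>, which the images eventually avoid.\<close>

lemma subcontinuous_finite_cover:
  assumes sub: "subcontinuous X Y A f" and x: "x \<in> topspace X"
    and op: "\<And>V. V \<in> \<V> \<Longrightarrow> openin Y V"
    and cov: "\<And>y. (x, y) \<in> prod_topology X Y closure_of function_graph A f \<Longrightarrow> y \<in> \<Union>\<V>"
  obtains U \<F> where "openin X U" "x \<in> U" "finite \<F>" "\<F> \<subseteq> \<V>" "f ` (U \<inter> A) \<subseteq> \<Union>\<F>"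
proof (rule ccontr)
  assume nt: "\<not> thesis"
  note cover = that
  define D where "D = {(U, \<F>). openin X U \<and> x \<in> U \<and> finite \<F> \<and> \<F> \<subseteq> \<V>}"
  define le where "le = (\<lambda>(U, \<F>) (U', \<F>'). U' \<subseteq> (U :: 'a set) \<and> \<F> \<subseteq> (\<F>' :: 'b set set))"
  have "\<exists>a. a \<in> fst e \<inter> A \<and> f a \<notin> \<Union>(snd e)" if "e \<in> D" for e
  proof -
    have "openin X (fst e)" "x \<in> fst e" "finite (snd e)" "snd e \<subseteq> \<V>"
      using \<open>e \<in> D\<close> by (auto simp: D_def)
    then have "\<not> f ` (fst e \<inter> A) \<subseteq> \<Union>(snd e)" using nt cover by metis
    then show ?thesis by blast
  qed
  then obtain s where s: "\<And>e. e \<in> D \<Longrightarrow> s e \<in> fst e \<inter> A \<and> f (s e) \<notin> \<Union>(snd e)"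
    by metis
  have inD: "(U, \<F>) \<in> D" if "openin X U" "x \<in> U" "finite \<F>" "\<F> \<subseteq> \<V>" for U \<F>
    using that by (simp add: D_def)
  have D: "directed_by D le"
    unfolding directed_by_def
  proof (intro conjI ballI impI)
    show "D \<noteq> {}" using inD[of "topspace X" "{}"] x by auto
    show "le a a" for a by (auto simp: le_def)
    show "le a c" if "le a b \<and> le b c" for a b c using that by (auto simp: le_def)
    show "\<exists>c\<in>D. le a c \<and> le b c" if "a \<in> D" "b \<in> D" for a b
      using that inD[of "fst a \<inter> fst b" "snd a \<union> snd b"]
      by (intro bexI[of _ "(fst a \<inter> fst b, snd a \<union> snd b)"]) (auto simp: le_def D_def)
  qed
  have "s \<in> D \<rightarrow> A" using s by blast
  moreover have lim: "net_converges X D le s x"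
    unfolding net_converges_def
  proof (intro conjI allI impI)
    fix U assume "openin X U \<and> x \<in> U"
    then have "(U, {}) \<in> D" by (simp add: inD)
    moreover have "s e \<in> U" if "e \<in> D" "le (U, {}) e" for e
      using s[OF that(1)] that(2) by (auto simp: le_def)
    ultimately show "\<exists>i\<in>D. \<forall>j\<in>D. le i j \<longrightarrow> s j \<in> U" by blast
  qed (rule x)
  \<comment> \<open>The indices are pairs of a neighbourhood and a finite family, so subcontinuity
    is needed for nets over an arbitrary index type.\<close>
  ultimately have "has_convergent_subnet Y D le (f \<circ> s)"
    using subcontinuous_netD[OF sub x D] by blast
  then obtain l where l: "l \<in> topspace Y"
    and cl0: "\<forall>V. openin Y V \<and> l \<in> V \<longrightarrow> (\<forall>i\<in>D. \<exists>j\<in>D. le i j \<and> (f \<circ> s) j \<in> V)"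
    unfolding has_convergent_subnet_iff_cluster_point[OF D] by (elim bexE)
  have cl: "\<exists>j\<in>D. le i j \<and> f (s j) \<in> V" if "openin Y V" "l \<in> V" "i \<in> D" for V i
    using cl0 that by simp
  have "function_graph A f \<inter> U \<times> V \<noteq> {}"
    if UV: "openin X U" "openin Y V" "x \<in> U" "l \<in> V" for U V
  proof -
    \<comment> \<open>The index \<open>(U, {})\<close> imposes only closeness to
      \<open>x\<close>.\<close>
    obtain j where j: "j \<in> D" "le (U, {}) j" "f (s j) \<in> V"
      using cl[OF UV(2,4) inD[of U "{}"]] UV(1,3) by auto
    have "s j \<in> U \<inter> A" using s[OF j(1)] j(2) by (auto simp: le_def)
    then show ?thesis using j(3) unfolding function_graph_def by blast
  qed
  then have "(x, l) \<in> prod_topology X Y closure_of function_graph A f"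
    using x l by (simp add: in_closure_of_prod_topology)
  then obtain V where V: "V \<in> \<V>" "l \<in> V" using cov by blast
  \<comment> \<open>The index \<open>(topspace X, {V})\<close> imposes only that the images avoid
    \<open>V\<close>.\<close>
  obtain j where j: "j \<in> D" "le (topspace X, {V}) j" "f (s j) \<in> V"
    using cl[OF op[OF V(1)] V(2) inD[of "topspace X" "{V}"]] V(1) x by auto
  then show False using s[OF j(1)] by (auto simp: le_def)
qed

lemma regular_space_closure_nbhd:
  assumes "regular_space Y" "openin Y V" "y \<in> V"
  obtains W where "openin Y W" "y \<in> W" "Y closure_of W \<subseteq> V"
proof -
  obtain W K where "openin Y W" "closedin Y K" "y \<in> W" "W \<subseteq> K" "K \<subseteq> V"
    using assms unfolding neighbourhood_base_of_closedin[symmetric] neighbourhood_base_of by metis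
  then show thesis using that closure_of_minimal by (metis subset_trans)
qed

text \<open>Regularity allows \<open>F x\<close> to be covered by open sets whose closures lie in
  members of \<open>\<V>\<close>. Finitely many of them cover the values of \<open>f\<close> near
  \<open>x\<close>, so their closures cover the values of \<open>F\<close> there.\<close>

lemma subcontinuous_closure_finite_cover:
  assumes sub: "subcontinuous X Y A f" and reg: "regular_space Y" and x: "x \<in> topspace X"
    and F: "prod_topology X Y closure_of function_graph A f = map_graph X F"
    and op: "\<And>V. V \<in> \<V> \<Longrightarrow> openin Y V" and cov: "F x \<subseteq> \<Union>\<V>"
  obtains U \<F> where "openin X U" "x \<in> U" "finite \<F>" "\<F> \<subseteq> \<V>" "\<And>u. u \<in> U \<Longrightarrow> F u \<subseteq> \<Union>\<F>"
proof -
  define \<W> where "\<W> = {W. openin Y W \<and> (\<exists>V\<in>\<V>. Y closure_of W \<subseteq> V)}"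
  have "y \<in> \<Union>\<W>" if "(x, y) \<in> prod_topology X Y closure_of function_graph A f" for y
  proof -
    have "y \<in> F x" using that unfolding F by (simp add: map_graph_def)
    then obtain V where V: "V \<in> \<V>" "y \<in> V" using cov by blast
    obtain W where W: "openin Y W" "y \<in> W" "Y closure_of W \<subseteq> V"
      using regular_space_closure_nbhd[OF reg op[OF V(1)] V(2)] by metis
    then have "W \<in> \<W>" using V(1) by (auto simp: \<W>_def)
    then show ?thesis using W(2) by blast
  qed
  moreover have "openin Y W" if "W \<in> \<W>" for W using that by (simp add: \<W>_def)
  ultimately obtain U \<G> where U: "openin X U" "x \<in> U" "finite \<G>" "\<G> \<subseteq> \<W>" "f ` (U \<inter> A) \<subseteq> \<Union>\<G>"
    using subcontinuous_finite_cover[OF sub x, of \<W>] by metis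
  have "\<exists>V. V \<in> \<V> \<and> Y closure_of W \<subseteq> V" if "W \<in> \<G>" for W
    using that U(4) by (auto simp: \<W>_def)
  then obtain h where h: "\<And>W. W \<in> \<G> \<Longrightarrow> h W \<in> \<V> \<and> Y closure_of W \<subseteq> h W"
    by metis
  have "F u \<subseteq> \<Union>(h ` \<G>)" if u: "u \<in> U" for u
  proof
    fix y assume "y \<in> F u"
    then have "(u, y) \<in> prod_topology X Y closure_of function_graph A f"
      using openin_subset[OF U(1)] u unfolding F by (auto simp: map_graph_def)
    then have "y \<in> Y closure_of \<Union>\<G>"
      using closure_function_graph_value U(1,5) u by metis
    \<comment> \<open>Since \<open>\<G>\<close> is finite, the closure of its union is the union of
      the closures.\<close>
    then show "y \<in> \<Union>(h ` \<G>)"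
      using h U(3) by (auto simp: closure_of_Union)
  qed
  moreover have "finite (h ` \<G>)" "h ` \<G> \<subseteq> \<V>" using U(3) h by auto
  ultimately show thesis using that U(1,2) by metis
qed

text \<open>Each property is a finite cover statement: the family \<open>{V}\<close> gives upper
  semicontinuity, arbitrary open covers evaluated at \<open>x\<close> itself give compactness, and
  the empty family together with density of \<open>A\<close> gives nonempty values.\<close>

lemma usco_closure_of_subcontinuous:
  assumes dense: "X closure_of A = topspace X" and sub: "subcontinuous X Y A f"
    and reg: "regular_space Y" and svm: "set_valued_map X Y F"
    and F: "prod_topology X Y closure_of function_graph A f = map_graph X F"
  shows "usco X Y F"
  unfolding usco_def
proof (intro conjI ballI)
  show "set_valued_map X Y F" by (rule svm)
  show "upper_semicontinuous X Y F"
    unfolding upper_semicontinuous_def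
  proof (intro ballI allI impI)
    fix x V assume x: "x \<in> topspace X" and V: "openin Y V \<and> F x \<subseteq> V"
    then have "openin Y W" if "W \<in> {V}" for W using that by simp
    moreover have "F x \<subseteq> \<Union>{V}" using V by simp
    ultimately obtain U \<F> where U: "openin X U" "x \<in> U" "\<F> \<subseteq> {V}"
      "\<And>u. u \<in> U \<Longrightarrow> F u \<subseteq> \<Union>\<F>"
      using subcontinuous_closure_finite_cover[OF sub reg x F, of "{V}"] by metis
    have "(\<Union>u\<in>U. F u) \<subseteq> V"
    proof (rule UN_least)
      fix u assume "u \<in> U"
      then have "F u \<subseteq> \<Union>\<F>" by (rule U(4))
      then show "F u \<subseteq> V" using U(3) by blast
    qed
    then show "\<exists>U. openin X U \<and> x \<in> U \<and> (\<Union>u\<in>U. F u) \<subseteq> V" using U(1,2) by blast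
  qed
next
  fix x assume x: "x \<in> topspace X"
  show "F x \<noteq> {}"
  proof
    \<comment> \<open>The empty family would cover \<open>F x\<close>, so some neighbourhood of
      \<open>x\<close> would contain no point of the dense set \<open>A\<close>.\<close>
    assume "F x = {}"
    then have "y \<in> \<Union>{}" if "(x, y) \<in> prod_topology X Y closure_of function_graph A f" for y
      using that unfolding F by (simp add: map_graph_def)
    moreover have "openin Y V" if "V \<in> {}" for V using that by simp
    ultimately obtain U \<F> where U: "openin X U" "x \<in> U" "\<F> \<subseteq> {}" "f ` (U \<inter> A) \<subseteq> \<Union>\<F>"
      using subcontinuous_finite_cover[OF sub x, of "{}"] by metis
    then have "U \<inter> A = {}" by auto
    moreover have "x \<in> X closure_of A" using x dense by simp
    ultimately show False using U(1,2) unfolding in_closure_of by blast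
  qed
  show "compactin Y (F x)"
    unfolding compactin_def
  proof (intro conjI allI impI)
    show "F x \<subseteq> topspace Y" using svm x unfolding set_valued_map_def by blast
    fix \<V> assume "Ball \<V> (openin Y) \<and> F x \<subseteq> \<Union>\<V>"
    then have "\<And>V. V \<in> \<V> \<Longrightarrow> openin Y V" "F x \<subseteq> \<Union>\<V>" by auto
    then obtain U \<F> where "x \<in> U" "finite \<F>" "\<F> \<subseteq> \<V>" "\<And>u. u \<in> U \<Longrightarrow> F u \<subseteq> \<Union>\<F>"
      using subcontinuous_closure_finite_cover[OF sub reg x F, of \<V>] by metis
    then show "\<exists>\<F>. finite \<F> \<and> \<F> \<subseteq> \<V> \<and> F x \<subseteq> \<Union>\<F>" by metis
  qed
qed

section \<open>Minimality of the closure and the equivalence\<close>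

text \<open>If \<open>y \<in> F x - G x\<close>, then near \<open>x\<close> the map \<open>G\<close>
  stays in an open \<open>V\<close> disjoint from a neighbourhood \<open>W\<close> of
  \<open>y\<close>, while quasicontinuity makes \<open>f\<close> map a nonempty relatively open set
  into \<open>W\<close>. On that set the values of \<open>F\<close>, hence of \<open>G\<close>, lie
  in the closure of \<open>W\<close>, which cannot meet the open set \<open>V\<close>.\<close>

lemma minimal_closure_of_quasicontinuous:
  assumes Y: "Hausdorff_space Y" and quasi: "quasicontinuous_on X Y A f"
    and svm: "set_valued_map X Y F"
    and F: "prod_topology X Y closure_of function_graph A f = map_graph X F"
    and G: "usco X Y G" "\<And>x. x \<in> topspace X \<Longrightarrow> G x \<subseteq> F x"
    and x: "x \<in> topspace X"
  shows "F x \<subseteq> G x"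
proof (rule ccontr)
  assume "\<not> F x \<subseteq> G x"
  then obtain y where y: "y \<in> F x" "y \<notin> G x" by blast
  have yY: "y \<in> topspace Y" using svm x y unfolding set_valued_map_def by blast
  obtain U V W where UVW: "openin X U" "x \<in> U" "openin Y V" "openin Y W" "y \<in> W" "disjnt V W"
    "\<And>u. u \<in> U \<Longrightarrow> G u \<subseteq> V"
    using usco_separation[OF Y G(1) x yY y(2)] by metis
  have "(x, y) \<in> prod_topology X Y closure_of function_graph A f"
    using x y unfolding F by (simp add: map_graph_def)
  then have "function_graph A f \<inter> U \<times> W \<noteq> {}"
    using UVW by (simp add: in_closure_of_prod_topology)
  then obtain a where a: "a \<in> A" "a \<in> U" "f a \<in> W" by (auto simp: function_graph_def)
  have "openin (subtopology X A) (U \<inter> A)" using UVW(1) by (auto simp: openin_subtopology)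
  then obtain H where H: "openin (subtopology X A) H" "H \<noteq> {}" "H \<subseteq> U \<inter> A" "f ` H \<subseteq> W"
    using quasi a UVW(4) unfolding quasicontinuous_on_def by (metis IntI)
  \<comment> \<open>An open set of \<open>X\<close> with trace \<open>H\<close> on \<open>A\<close>
    is what controls the closure of the graph over the points of \<open>H\<close>.\<close>
  obtain T where T: "openin X T" "H = T \<inter> A" using H(1) by (auto simp: openin_subtopology)
  obtain h where h: "h \<in> H" using H by blast
  then have hU: "h \<in> U" "h \<in> T" "h \<in> topspace X"
    using H T openin_subset[OF UVW(1)] by auto
  then obtain z where z: "z \<in> G h" using G(1) unfolding usco_def by blast
  then have "(h, z) \<in> prod_topology X Y closure_of function_graph A f"
    using hU G(2) unfolding F by (auto simp: map_graph_def)
  then have "z \<in> Y closure_of W"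
    using closure_function_graph_value[OF _ T(1)] hU(2) H(4) T(2) by metis
  moreover have "z \<in> V" using UVW(7) hU z by blast
  ultimately show False using UVW(3,6) unfolding in_closure_of disjnt_def by blast
qed

theorem theorem2p4:
  fixes X :: "'a topology" and Y :: "'b topology" and F :: "'a \<Rightarrow> 'b set"
  assumes "Hausdorff_space X"
    and "t1_space Y" and "regular_space Y"
    and "set_valued_map X Y F"
  shows "minimal_usco X Y F \<longleftrightarrow>
    (\<exists>A f. densely_defined_selection X Y F A f \<and>
           quasicontinuous_on X Y A f \<and>
           subcontinuous X Y A f \<and>
           prod_topology X Y closure_of function_graph A f = map_graph X F)"
proof -
  have Y: "Hausdorff_space Y" using assms(2,3) regular_t1_imp_Hausdorff_space by blast
  show ?thesis
  proof
    assume min: "minimal_usco X Y F"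
    then have us: "usco X Y F" unfolding minimal_usco_def by simp
    then have "\<exists>y. y \<in> F x" if "x \<in> topspace X" for x
      using that unfolding usco_def by blast
    then obtain f where f: "\<And>x. x \<in> topspace X \<Longrightarrow> f x \<in> F x"
      by metis
    \<comment> \<open>The selection is taken on the whole space, so density of its domain is
      automatic.\<close>
    have "densely_defined_selection X Y F (topspace X) f"
      using f assms(4)
      by (auto simp: densely_defined_selection_def densely_defined_def set_valued_map_def)
    then show "\<exists>A f. densely_defined_selection X Y F A f \<and> quasicontinuous_on X Y A f \<and>
        subcontinuous X Y A f \<and>
        prod_topology X Y closure_of function_graph A f = map_graph X F"
      using usco_selection_subcontinuous[OF us f] minimal_usco_selection[OF Y min f] by blast
  next
    assume "\<exists>A f. densely_defined_selection X Y F A f \<and> quasicontinuous_on X Y A f \<and>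
        subcontinuous X Y A f \<and>
        prod_topology X Y closure_of function_graph A f = map_graph X F"
    then obtain A f where Af: "densely_defined_selection X Y F A f" "quasicontinuous_on X Y A f"
      "subcontinuous X Y A f" "prod_topology X Y closure_of function_graph A f = map_graph X F"
      by (elim exE conjE)
    have "X closure_of A = topspace X"
      using Af(1) unfolding densely_defined_selection_def densely_defined_def by simp
    then have "usco X Y F"
      using usco_closure_of_subcontinuous Af(3,4) assms(3,4) by metis
    then show "minimal_usco X Y F"
      using minimal_closure_of_quasicontinuous[OF Y Af(2) assms(4) Af(4)]
      unfolding minimal_usco_def by blast
  qed
qed

end
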